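(* Let $\mathcal{G}$ be a finite connected graph without self-edges, with vertex set $\mathcal{V}(\mathcal{G})$ and with a weight (transition rate) $k(x,y)>0$ assigned to every oriented edge $(x,y)$. Let $L$ be the backward generator of the associated Markov jump process, and let $\rho^s$ be its unique stationary probability distribution. Let $f:\mathcal{V}(\mathcal{G})\to\mathbb{R}$ be a function with $\langle f\rangle^s=\sum_{x\in\mathcal{V}(\mathcal{G})}\rho^s(x)f(x)=0$, and let $$V_f=\int_0^\infty S(t)f\,dt,\qquad S(t)=e^{tL},$$ be the quasipotential of $f$. Then $$V_f=-L_D^{-1}f,$$ where $L_D^{-1}$ is the Drazin inverse of $L$.
   Context: Setting. Each edge $\{x,y\}$ of the graph $\mathcal{G}$ can be traversed in both orientations, and both oriented edges carry strictly positive weights: $k(x,y)>0$ and $k(y,x)>0$ whenever $x,y$ are joined by an edge. Put $k(x,y)=0$ if there is no edge between $x$ and $y$. There are no self-edges. Let $n=|\mathcal{V}(\mathcal{G})|$. Backward generator. $L$ is the $n\times n$ matrix indexed by vertices, with $L_{x,y}=k(x,y)$ for $x\neq y$ and $L_{x,x}=-\sum_{y\ne x}k(x,y)$. Functions $g$ on $\mathcal{V}(\mathcal{G})$ are column vectors on which $L$ acts by matrix multiplication. Probability distributions are row vectors. The stationary distribution $\rho^s>0$ is the unique probability vector with $\rho^sL=0$. For every $g$, $(e^{tL}g)(x)\to\langle g\rangle^s:=\sum_y\rho^s(y)g(y)$ exponentially fast as $t\to\infty$, uniformly in $x$, so the integral defining $V_f$ converges when $\langle f\rangle^s=0$. Drazin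 inverse. For a square matrix $A\in\mathbb{C}^{n\times n}$, the index $\mathrm{ind}(A)$ is the smallest non-negative integer $k$ such that $\mathrm{rank}(A^k)=\mathrm{rank}(A^{k+1})$. The Drazin inverse $A_D^{-1}$ is the unique matrix satisfying (1) $A^kA_D^{-1}A=A^k$ with $k=\mathrm{ind}(A)$, (2) $A_D^{-1}AA_D^{-1}=A_D^{-1}$, (3) $AA_D^{-1}=A_D^{-1}A$. *)

theory Defs
  imports
    "HOL-Analysis.Analysis"
    "Graph_Theory.Digraph_Component"
begin

definition generator :: "('v::finite \<Rightarrow> 'v \<Rightarrow> real) \<Rightarrow> real^'v^'v" where
  "generator k = (\<chi> x y. if x = y then - (\<Sum>z\<in>UNIV - {x}. k x z) else k x y)"

definition stationary_distribution :: "real^'v^'v \<Rightarrow> real^'v::finite \<Rightarrow> bool" where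
  "stationary_distribution L \<rho> \<longleftrightarrow>
     (\<forall>x. \<rho> $ x \<ge> 0) \<and> (\<Sum>x\<in>UNIV. \<rho> $ x) = 1 \<and> \<rho> v* L = 0"

text \<open>On the type of square matrices, \<open>(*)\<close>, \<open>(^)\<close> and \<open>1\<close> are entrywise, so that
  powers and the exponential have to be built from the matrix product \<open>(**)\<close>.\<close>

definition matrix_power :: "'a::semiring_1^'n^'n::finite \<Rightarrow> nat \<Rightarrow> 'a^'n^'n" where
  "matrix_power A m = (((**) A) ^^ m) (mat 1)"

definition matrix_exp :: "real^'n^'n::finite \<Rightarrow> real^'n^'n" where
  "matrix_exp A = (\<Sum>m. matrix_power A m /\<^sub>R fact m)"

definition backward_semigroup :: "real^'n^'n::finite \<Rightarrow> real \<Rightarrow> real^'n^'n" where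
  "backward_semigroup L t = matrix_exp (t *\<^sub>R L)"

definition quasipotential :: "real^'n^'n::finite \<Rightarrow> real^'n \<Rightarrow> real^'n" where
  "quasipotential L f = integral {0..} (\<lambda>t. backward_semigroup L t *v f)"

definition matrix_index :: "'a::field^'n^'n::finite \<Rightarrow> nat" where
  "matrix_index A = (LEAST m. rank (matrix_power A m) = rank (matrix_power A (Suc m)))"

definition is_drazin_inverse :: "'a::field^'n^'n::finite \<Rightarrow> 'a^'n^'n \<Rightarrow> bool" where
  "is_drazin_inverse A D \<longleftrightarrow>
     matrix_power A (matrix_index A) ** D ** A = matrix_power A (matrix_index A) \<and>
     D ** A ** D = D \<and>
     A ** D = D ** A"

definition drazin_inverse :: "'a::field^'n^'n::finite \<Rightarrow> 'a^'n^'n" where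
  "drazin_inverse A = (THE D. is_drazin_inverse A D)"

text \<open>The Drazin inverse is sought among complex matrices, so the real \<open>L\<close> and \<open>f\<close> are
  embedded, the matrix by \<open>map_matrix complex_of_real\<close>.\<close>

definition complex_vector :: "real^'n::finite \<Rightarrow> complex^'n" where
  "complex_vector v = (\<chi> i. complex_of_real (v $ i))"

end

theory Submission
  imports Defs "HOL-Real_Asymp.Real_Asymp"
begin

text \<open>Let \<open>P\<close> be the matrix all of whose rows are \<open>\<rho>\<close>. The matrix \<open>L - P\<close> is invertible, and
  \<open>D = (L - P)\<^sup>-\<^sup>1 + P\<close> commutes with \<open>L\<close> and satisfies \<open>L D = 1 - P\<close>, \<open>P D = 0\<close>; so \<open>D\<close> is the
  Drazin inverse of \<open>L\<close>. If \<open>\<langle>f\<rangle> = 0\<close>, then \<open>S(t) f = S(t) L D f\<close> is the derivative of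
  \<open>S(t) D f\<close>, hence the integral of \<open>S(t) f\<close> over \<open>[0, T]\<close> is \<open>S(T) D f - D f\<close>. Since
  \<open>\<langle>D f\<rangle> = 0\<close>, the energy \<open>\<Sum>x. \<rho>(x) (S(t) D f)(x)\<^sup>2\<close> decays exponentially: its derivative is minus
  the Dirichlet form, which a Poincare inequality bounds below on functions of mean zero.\<close>

section \<open>Matrix products and the Drazin inverse\<close>

lemma matrix_diff_ldistrib: "A ** (B - C) = A ** B - A ** C"
  for A :: "'a::ring_1^'n^'m"
  by (simp add: matrix_matrix_mult_def vec_eq_iff sum_subtractf right_diff_distrib)

lemma matrix_diff_rdistrib: "(A - B) ** C = A ** C - B ** C"
  for A :: "'a::ring_1^'n^'m"
  by (simp add: matrix_matrix_mult_def vec_eq_iff sum_subtractf left_diff_distrib)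

lemma matrix_add_rdistrib: "(A + B) ** C = A ** C + B ** C"
  for A :: "'a::semiring_1^'n^'m"
  by (simp add: matrix_matrix_mult_def vec_eq_iff sum.distrib distrib_right)

lemma map_matrix_of_real_mult:
  "map_matrix of_real (A ** B) =
    map_matrix (of_real :: real \<Rightarrow> 'a::real_algebra_1) A ** map_matrix of_real B"
  by (simp add: matrix_matrix_mult_def vec_eq_iff)

lemma matrix_power_0: "matrix_power A 0 = mat 1"
  by (simp add: matrix_power_def)

lemma matrix_power_Suc: "matrix_power A (Suc m) = A ** matrix_power A m"
  by (simp add: matrix_power_def)

lemma matrix_power_commute: "A ** matrix_power A m = matrix_power A m ** A"
proof (induction m)
  case (Suc m)
  then show ?case
    by (metis matrix_mul_assoc matrix_power_Suc)
qed (simp add: matrix_power_0)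

lemma matrix_power_scaleR: "matrix_power (t *\<^sub>R A) m = t ^ m *\<^sub>R matrix_power A m"
  for A :: "real^'n^'n"
proof (induction m)
  case (Suc m)
  then show ?case
    by (simp add: matrix_power_Suc matrix_matrix_mult_def vec_eq_iff sum_distrib_left mult_ac)
qed (simp add: matrix_power_0)

lemma rows_mult_subset_span: "rows (B ** A) \<subseteq> vec.span (rows A)"
  for A :: "'a::field^'n^'m"
proof
  fix r assume "r \<in> rows (B ** A)"
  then obtain i where r: "r = row i (B ** A)"
    by (auto simp: rows_def)
  have "r = (\<Sum>j\<in>UNIV. B $ i $ j *s row j A)"
    by (simp add: r row_def matrix_matrix_mult_def vec_eq_iff)
  also have "\<dots> \<in> vec.span (rows A)"
    by (intro vec.span_sum vec.span_scale vec.span_base) (auto simp: rows_def)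
  finally show "r \<in> vec.span (rows A)" .
qed

lemma rank_mult_le: "rank (B ** A) \<le> rank A"
  for A :: "'a::field^'n^'m"
  unfolding row_rank_def_gen
  using vec.dim_mono[OF rows_mult_subset_span[of B A]] by simp

text \<open>Full rank is phrased as the rank of \<open>mat 1\<close> because index zero yields it in
  that form, \<open>mat 1\<close> being the zeroth power.\<close>

lemma left_invertible_if_full_rank:
  fixes A :: "'a::field^'n^'n"
  assumes "rank A = rank (mat 1 :: 'a^'n^'n)"
  shows "\<exists>B. B ** A = mat 1"
proof -
  have "vec.span (rows (mat 1 :: 'a^'n^'n)) = UNIV"
    using matrix_left_invertible_span_rows_gen[of "mat 1 :: 'a^'n^'n"] matrix_mul_lid by blast
  then have "vec.span (rows A) = UNIV"
    using assms by (simp add: row_rank_def_gen flip: vec.dim_eq_full)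
  then show ?thesis
    using matrix_left_invertible_span_rows_gen[of A] by blast
qed

text \<open>The three equations define the group inverse, which exists only when the index is at
  most one.\<close>

lemma drazin_inverse_eqI:
  fixes A D :: "'a::field^'n^'n"
  assumes ADA: "A ** D ** A = A" and DAD: "D ** A ** D = D" and comm: "A ** D = D ** A"
  shows "drazin_inverse A = D"
proof -
  \<comment> \<open>Commuting \<open>A\<close> past \<open>D\<close> in \<open>ADA\<close> shows
    that squaring loses no rank, so the index is 0 or 1.\<close>
  have "A = D ** (A ** A)"
    by (metis ADA comm matrix_mul_assoc)
  then have "rank A = rank (A ** A)"
    by (metis antisym rank_mult_le)
  then have stable: "rank (matrix_power A 1) = rank (matrix_power A (Suc 1))"
    by (simp add: matrix_power_Suc matrix_power_0)
  then have le1: "matrix_index A \<le> 1"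
    unfolding matrix_index_def by (rule Least_le)
  have attained: "rank (matrix_power A (matrix_index A)) = rank (matrix_power A (Suc (matrix_index A)))"
    unfolding matrix_index_def using stable by (rule LeastI)
  show ?thesis
    unfolding drazin_inverse_def
  proof (rule the_equality)
    have "matrix_power A (matrix_index A) ** D ** A = matrix_power A (matrix_index A)"
    proof (cases "matrix_index A")
      case 0
      \<comment> \<open>At index 0 the first equation demands \<open>D ** A = mat 1\<close>;
        cancelling \<open>A\<close> from the left in \<open>ADA\<close> gives it.\<close>
      then obtain B where "B ** A = mat 1"
        using attained left_invertible_if_full_rank[of A]
        by (auto simp: matrix_power_Suc matrix_power_0)
      then have "D ** A = mat 1"
        by (metis ADA matrix_mul_assoc matrix_mul_lid)
      then show ?thesis
        using 0 by (simp add: matrix_power_0)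
    next
      case (Suc m)
      then have "matrix_index A = Suc 0" using le1 by simp
      then show ?thesis
        using ADA by (simp add: matrix_power_Suc matrix_power_0)
    qed
    then show "is_drazin_inverse A D"
      using DAD comm by (simp add: is_drazin_inverse_def)
  next
    fix E assume E: "is_drazin_inverse A E"
    then have EAE: "E ** A ** E = E" and AE: "A ** E = E ** A"
      and pow: "matrix_power A (matrix_index A) ** E ** A = matrix_power A (matrix_index A)"
      by (auto simp: is_drazin_inverse_def)
    have AEA: "A ** E ** A = A"
    proof (cases "matrix_index A")
      case 0
      then show ?thesis
        using pow by (metis matrix_mul_assoc matrix_mul_lid matrix_mul_rid matrix_power_0)
    next
      case (Suc m)
      then have "matrix_index A = Suc 0" using le1 by simp
      then show ?thesis
        using pow by (simp add: matrix_power_Suc matrix_power_0)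
    qed
    \<comment> \<open>Commutation and \<open>AEA\<close> collapse this product to
      \<open>D ** A\<close>, so \<open>A ** E\<close> and \<open>A ** D\<close> agree; moving this
      common projection then turns \<open>E\<close> into \<open>D\<close>.\<close>
    have "A ** E = A ** D ** A ** E"
      by (simp add: ADA)
    also have "\<dots> = D ** (A ** E ** A)"
      by (metis AE comm matrix_mul_assoc)
    finally have eq: "A ** E = A ** D"
      by (simp add: AEA comm)
    have "E = E ** (A ** D)"
      by (metis EAE eq matrix_mul_assoc)
    also have "\<dots> = A ** D ** D"
      by (metis AE eq matrix_mul_assoc)
    also have "\<dots> = D"
      by (metis DAD comm)
    finally show "E = D" .
  qed
qed

section \<open>The matrix exponential\<close>

text \<open>The maximal absolute row sum is a submultiplicative norm, so powers grow at most
  geometrically; \<open>c\<close> is any bound on it.\<close>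

lemma matrix_power_entry_bound:
  fixes A :: "real^'n^'n"
  assumes "\<And>i. (\<Sum>j\<in>UNIV. \<bar>A $ i $ j\<bar>) \<le> c"
  shows "\<bar>matrix_power A m $ i $ j\<bar> \<le> c ^ m"
proof (induction m arbitrary: i)
  case 0
  then show ?case by (simp add: matrix_power_0 mat_def)
next
  case (Suc m)
  have c: "0 \<le> c"
    using assms[of i] by (meson abs_ge_zero order_trans sum_nonneg)
  have "\<bar>matrix_power A (Suc m) $ i $ j\<bar> \<le> (\<Sum>l\<in>UNIV. \<bar>A $ i $ l\<bar> * \<bar>matrix_power A m $ l $ j\<bar>)"
    unfolding matrix_power_Suc matrix_matrix_mult_def
    using sum_abs[of "\<lambda>l. A $ i $ l * matrix_power A m $ l $ j" UNIV] by (simp add: abs_mult)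
  also have "\<dots> \<le> (\<Sum>l\<in>UNIV. \<bar>A $ i $ l\<bar> * c ^ m)"
    by (intro sum_mono mult_left_mono Suc.IH) simp
  also have "\<dots> \<le> c * c ^ m"
    unfolding sum_distrib_right[symmetric] using c by (intro mult_right_mono assms) simp
  finally show ?case by simp
qed

lemma summable_matrix_power_entry:
  fixes A :: "real^'n^'n"
  shows "summable (\<lambda>m. matrix_power A m $ i $ j / fact m * t ^ m)"
proof -
  define c where "c = (\<Sum>i\<in>UNIV. \<Sum>j\<in>UNIV. \<bar>A $ i $ j\<bar>)"
  have "(\<Sum>j\<in>UNIV. \<bar>A $ i $ j\<bar>) \<le> c" for i
    unfolding c_def by (rule member_le_sum) (auto intro: sum_nonneg)
  then have bound: "\<bar>matrix_power A m $ i $ j\<bar> \<le> c ^ m" for m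
    by (rule matrix_power_entry_bound)
  show ?thesis
  proof (rule summable_comparison_test')
    show "summable (\<lambda>m. (c * \<bar>t\<bar>) ^ m /\<^sub>R fact m)"
      by (rule summable_exp_generic)
    show "norm (matrix_power A m $ i $ j / fact m * t ^ m) \<le> (c * \<bar>t\<bar>) ^ m /\<^sub>R fact m" for m
      using mult_right_mono[OF bound[of m], of "\<bar>t\<bar> ^ m / fact m"]
      by (simp add: abs_mult power_abs power_mult_distrib divide_simps)
  qed
qed

text \<open>Convergence of matrices is entrywise, so the exponential reduces to scalar power series
  in \<open>t\<close>, to which termwise differentiation applies.\<close>

lemma backward_semigroup_entry:
  "backward_semigroup A t $ i $ j = (\<Sum>m. matrix_power A m $ i $ j / fact m * t ^ m)"
proof -
  have "(\<lambda>m. matrix_power (t *\<^sub>R A) m /\<^sub>R fact m) sums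
      (\<chi> i j. \<Sum>m. matrix_power A m $ i $ j / fact m * t ^ m)"
    unfolding sums_def
  proof (intro vec_tendstoI)
    fix i j
    have "(\<lambda>m. matrix_power A m $ i $ j / fact m * t ^ m) sums
        (\<Sum>m. matrix_power A m $ i $ j / fact m * t ^ m)"
      using summable_matrix_power_entry by (rule summable_sums)
    then show "(\<lambda>n. (\<Sum>m<n. matrix_power (t *\<^sub>R A) m /\<^sub>R fact m) $ i $ j) \<longlonglongrightarrow>
        (\<chi> i j. \<Sum>m. matrix_power A m $ i $ j / fact m * t ^ m) $ i $ j"
      by (simp add: sums_def matrix_power_scaleR divide_inverse mult_ac)
  qed
  then show ?thesis
    unfolding backward_semigroup_def matrix_exp_def by (simp add: sums_iff)
qed

lemma backward_semigroup_0: "backward_semigroup A 0 = mat 1"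
  by (simp only: vec_eq_iff backward_semigroup_entry powser_zero) (simp add: matrix_power_0)

text \<open>Multiplying by \<open>A\<close> on either side shifts the coefficients to the next
  power. Both products thus share one series, which is also the derivative of the exponential
  series.\<close>

lemma backward_semigroup_mult_left_entry:
  "(A ** backward_semigroup A t) $ i $ j =
    (\<Sum>m. matrix_power A (Suc m) $ i $ j / fact m * t ^ m)"
proof -
  have "(\<lambda>m. \<Sum>l\<in>UNIV. A $ i $ l * (matrix_power A m $ l $ j / fact m * t ^ m)) sums
      (\<Sum>l\<in>UNIV. A $ i $ l * (\<Sum>m. matrix_power A m $ l $ j / fact m * t ^ m))"
    by (intro sums_sum sums_mult summable_sums summable_matrix_power_entry)
  moreover have "(\<Sum>l\<in>UNIV. A $ i $ l * (matrix_power A m $ l $ j / fact m * t ^ m)) =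
      matrix_power A (Suc m) $ i $ j / fact m * t ^ m" for m
    by (simp add: matrix_power_Suc matrix_matrix_mult_def sum_distrib_left sum_divide_distrib mult_ac)
  ultimately show ?thesis
    by (simp add: matrix_matrix_mult_def backward_semigroup_entry sums_iff)
qed

lemma backward_semigroup_mult_right_entry:
  "(backward_semigroup A t ** A) $ i $ j =
    (\<Sum>m. matrix_power A (Suc m) $ i $ j / fact m * t ^ m)"
proof -
  have "(\<lambda>m. \<Sum>l\<in>UNIV. (matrix_power A m $ i $ l / fact m * t ^ m) * A $ l $ j) sums
      (\<Sum>l\<in>UNIV. (\<Sum>m. matrix_power A m $ i $ l / fact m * t ^ m) * A $ l $ j)"
    by (intro sums_sum sums_mult2 summable_sums summable_matrix_power_entry)
  moreover have "(\<Sum>l\<in>UNIV. (matrix_power A m $ i $ l / fact m * t ^ m) * A $ l $ j) =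
      matrix_power A (Suc m) $ i $ j / fact m * t ^ m" for m
    unfolding matrix_power_Suc matrix_power_commute
    by (simp add: matrix_matrix_mult_def sum_distrib_left sum_divide_distrib mult_ac)
  ultimately show ?thesis
    by (simp add: matrix_matrix_mult_def backward_semigroup_entry sums_iff)
qed

lemma backward_semigroup_commute: "A ** backward_semigroup A t = backward_semigroup A t ** A"
  by (simp add: vec_eq_iff backward_semigroup_mult_left_entry backward_semigroup_mult_right_entry)

lemma backward_semigroup_entry_deriv:
  "((\<lambda>t. backward_semigroup A t $ i $ j) has_real_derivative
    (A ** backward_semigroup A t) $ i $ j) (at t)"
proof -
  \<comment> \<open>The factor \<open>Suc m\<close> from differentiation cancels against
    \<open>fact (Suc m)\<close>.\<close>
  have "diffs (\<lambda>m. matrix_power A m $ i $ j / fact m) =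
      (\<lambda>m. matrix_power A (Suc m) $ i $ j / fact m)"
    by (simp add: diffs_def fun_eq_iff divide_simps)
  then show ?thesis
    using termdiffs_strong_converges_everywhere[OF summable_matrix_power_entry, of A i j t]
    by (simp add: backward_semigroup_entry backward_semigroup_mult_left_entry)
qed

section \<open>Calculus of vector-valued functions on the half-line\<close>

lemma has_vector_derivative_vecI:
  fixes u :: "real \<Rightarrow> real^'n"
  assumes "\<And>i. ((\<lambda>t. u t $ i) has_real_derivative u' $ i) (at t within S)"
  shows "(u has_vector_derivative u') (at t within S)"
  unfolding has_vector_derivative_def
proof (subst has_derivative_componentwise_within, rule ballI)
  fix b :: "real^'n" assume "b \<in> Basis"
  then obtain i where "b = axis i 1"
    by (auto simp: Basis_vec_def)
  then show "((\<lambda>t. u t \<bullet> b) has_derivative (\<lambda>h. h *\<^sub>R u' \<bullet> b)) (at t within S)"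
    using assms[of i] by (simp add: has_field_derivative_def inner_axis mult_commute_abs)
qed

text \<open>The backward equation along an orbit, with \<open>A\<close> on the left to give the
  shape u' = L u that the decay argument takes.\<close>

lemma backward_semigroup_mult_vec_deriv:
  "((\<lambda>t. backward_semigroup A t *v v) has_vector_derivative
    A *v (backward_semigroup A t *v v)) (at t)"
proof (rule has_vector_derivative_vecI)
  fix i
  have "((\<lambda>t. \<Sum>j\<in>UNIV. backward_semigroup A t $ i $ j * v $ j) has_real_derivative
      (\<Sum>j\<in>UNIV. (A ** backward_semigroup A t) $ i $ j * v $ j)) (at t)"
    by (intro DERIV_sum DERIV_cmult_right backward_semigroup_entry_deriv)
  then show "((\<lambda>t. (backward_semigroup A t *v v) $ i) has_real_derivative
      (A *v (backward_semigroup A t *v v)) $ i) (at t)"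
    unfolding matrix_vector_mul_assoc by (simp add: matrix_vector_mult_def)
qed

text \<open>The fundamental theorem on \<open>{0..b}\<close>, with b tending to infinity. For the
  gauge integral, integrability on bounded intervals and convergence over large ones
  suffice.\<close>

lemma has_integral_derivative_vanishing_at_top:
  fixes u :: "real \<Rightarrow> 'a::banach"
  assumes deriv: "\<And>t. 0 \<le> t \<Longrightarrow> (u has_vector_derivative u' t) (at t)"
    and lim: "(u \<longlongrightarrow> 0) at_top"
  shows "(u' has_integral - u 0) {0..}"
proof -
  have int: "(u' has_integral u b - u 0) {0..b}" if "0 \<le> b" for b
    using that deriv
    by (intro fundamental_theorem_of_calculus) (auto intro: has_vector_derivative_at_within)
  have inter: "{0..} \<inter> {a..b} = {max 0 a..b}" for a b :: real
    by auto
  have "(\<lambda>x. if x \<in> {0..} then u' x else 0) integrable_on cbox a b" for a b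
  proof -
    have "u' integrable_on {0..max 0 b}"
      using int[of "max 0 b"] by auto
    then have "u' integrable_on {max 0 a..b}"
      by (rule integrable_on_subinterval) auto
    then show ?thesis
      using integrable_restrict_Int[of "{0..}" u' "cbox a b"] by (simp add: inter)
  qed
  moreover have "\<exists>B>0. \<forall>a b. ball 0 B \<subseteq> cbox a b \<longrightarrow>
      norm (integral (cbox a b) (\<lambda>x. if x \<in> {0..} then u' x else 0) - - u 0) < e" if "e > 0" for e
  proof -
    obtain N where N: "\<And>b. b \<ge> N \<Longrightarrow> norm (u b) < e"
      using tendstoD[OF lim \<open>e > 0\<close>] by (auto simp: eventually_at_top_linorder)
    have "norm (integral (cbox a b) (\<lambda>x. if x \<in> {0..} then u' x else 0) - - u 0) < e"
      if sub: "ball 0 (max 1 N) \<subseteq> cbox a b" for a b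
    proof -
      \<comment> \<open>The open ball misses its endpoint \<open>max 1 N\<close>; passing to the
        closure yields \<open>N \<le> b\<close>. The 1 keeps the radius positive.\<close>
      have "closure (ball 0 (max 1 N)) \<subseteq> cbox a b"
        using sub by (intro closure_minimal) auto
      then have "cball 0 (max 1 N) \<subseteq> {a..b}"
        by (simp add: closure_ball)
      moreover have "max 1 N \<in> cball 0 (max 1 N)" "0 \<in> cball (0::real) (max 1 N)"
        by auto
      ultimately have ab: "a \<le> 0" "0 \<le> b" "N \<le> b"
        by (meson atLeastAtMost_iff subsetD max.boundedE)+
      have "integral (cbox a b) (\<lambda>x. if x \<in> {0..} then u' x else 0) = integral {0..b} u'"
        using ab Henstock_Kurzweil_Integration.integral_restrict_Int[of "cbox a b" "{0..}" u']
        by (simp add: Int_commute inter)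
      also have "\<dots> = u b - u 0"
        using int[OF ab(2)] by (rule integral_unique)
      finally show ?thesis
        using N ab by simp
    qed
    then show ?thesis
      by (intro exI[of _ "max 1 N"]) auto
  qed
  ultimately show ?thesis
    by (subst has_integral_alt') blast
qed

section \<open>Irreducible Markov generators\<close>

lemma generator_mult_vec: "(generator k *v u) $ x = (\<Sum>y\<in>UNIV. k x y * (u $ y - u $ x))"
proof -
  have "(generator k *v u) $ x =
      (\<Sum>y\<in>UNIV. if y = x then - (\<Sum>z\<in>UNIV - {x}. k x z) * u $ x else k x y * u $ y)"
    unfolding generator_def matrix_vector_mult_def by (auto intro!: sum.cong)
  also have "\<dots> = (\<Sum>y\<in>UNIV - {x}. k x y * u $ y) - (\<Sum>y\<in>UNIV - {x}. k x y * u $ x)"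
    by (subst sum.remove[of _ x]) (auto simp: sum_distrib_right)
  also have "\<dots> = (\<Sum>y\<in>UNIV - {x}. k x y * (u $ y - u $ x))"
    by (simp add: sum_subtractf right_diff_distrib)
  also have "\<dots> = (\<Sum>y\<in>UNIV. k x y * (u $ y - u $ x))"
    by (subst (2) sum.remove[of _ x]) auto
  finally show ?thesis .
qed

text \<open>Connectivity as an induction principle: it spreads zeros of \<open>\<rho>\<close>, and
  equality of the values of a function, over all vertices.\<close>

lemma rtrancl_UNIV_invariant:
  assumes "r\<^sup>* = UNIV" "P x" "\<And>x y. (x, y) \<in> r \<Longrightarrow> P x \<Longrightarrow> P y"
  shows "P y"
proof -
  have "(x, y) \<in> r\<^sup>*"
    using assms(1) by simp
  then show ?thesis
    by (induction rule: rtrancl_induct) (use assms in auto)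
qed

text \<open>The graph enters only through the relation of positive rates; its closure being
  \<open>UNIV\<close> expresses strong connectivity.\<close>

locale irreducible_markov =
  fixes k :: "'v::finite \<Rightarrow> 'v \<Rightarrow> real" and \<rho> :: "real^'v"
  assumes rate_nonneg: "k x y \<ge> 0"
    and irreducible: "{(x, y). k x y > 0}\<^sup>* = UNIV"
    and stationary: "stationary_distribution (generator k) \<rho>"
begin

abbreviation L where "L \<equiv> generator k"

text \<open>Twice the usual Dirichlet form: without the factor 1/2 it is exactly the dissipation
  rate of the weighted energy.\<close>

definition dirichlet :: "real^'v \<Rightarrow> real" where
  "dirichlet u = (\<Sum>x\<in>UNIV. \<rho> $ x * (\<Sum>y\<in>UNIV. k x y * (u $ y - u $ x)\<^sup>2))"

lemma inner_stationary_one: "\<rho> \<bullet> (\<chi> x. c) = c"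
  using stationary by (simp add: stationary_distribution_def inner_vec_def flip: sum_distrib_right)

lemma inner_stationary_generator: "\<rho> \<bullet> (L *v u) = 0"
  using stationary by (simp add: stationary_distribution_def flip: dot_lmul_matrix)

text \<open>A zero of \<open>\<rho>\<close> at \<open>x\<close> forces the inflow into
  \<open>x\<close> to vanish, hence zeros at all vertices with a positive rate to \<open>x\<close>.
  Spreading backwards, zeros would fill the graph, against total mass 1.\<close>

lemma stationary_pos: "\<rho> $ x > 0"
proof (rule ccontr)
  assume "\<not> \<rho> $ x > 0"
  moreover have nonneg: "\<rho> $ y \<ge> 0" for y
    using stationary by (simp add: stationary_distribution_def)
  ultimately have "\<rho> $ x = 0"
    by (meson dual_order.antisym not_less)
  have vanish_back: "\<rho> $ y = 0" if "\<rho> $ x = 0" "k y x > 0" for x y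
  proof (cases "y = x")
    case False
    have "(\<rho> v* L) $ x = 0"
      using stationary by (simp add: stationary_distribution_def)
    then have "(\<Sum>z\<in>UNIV - {x}. \<rho> $ z * k z x) = 0"
      using that(1)
      by (simp add: vector_matrix_mult_def generator_def sum.remove[of _ x] mult.commute)
    then have "\<rho> $ y * k y x = 0"
      using False nonneg rate_nonneg by (subst (asm) sum_nonneg_eq_0_iff) auto
    then show ?thesis
      using that(2) by simp
  qed (use that in simp)
  have "{(x, y). k y x > 0} = {(x, y). k x y > 0}\<inverse>"
    by auto
  then have "{(x, y). k y x > 0}\<^sup>* = UNIV"
    using irreducible by (simp add: rtrancl_converse)
  then have "\<rho> $ y = 0" for y
    using \<open>\<rho> $ x = 0\<close> vanish_back by (rule rtrancl_UNIV_invariant) auto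
  then show False
    using stationary by (simp add: stationary_distribution_def)
qed

text \<open>Stationarity enters through \<open>\<rho> \<bullet> L u\<^sup>2 = 0\<close>; no detailed balance is needed.\<close>

lemma dirichlet_eq: "2 * (\<Sum>x\<in>UNIV. \<rho> $ x * (u $ x * (L *v u) $ x)) = - dirichlet u"
proof -
  \<comment> \<open>Termwise this is b^2 - a^2 = 2a(b - a) + (b - a)^2.\<close>
  have "(L *v (\<chi> x. (u $ x)\<^sup>2)) $ x =
      2 * (u $ x * (L *v u) $ x) + (\<Sum>y\<in>UNIV. k x y * (u $ y - u $ x)\<^sup>2)" for x
    unfolding generator_mult_vec sum_distrib_left sum.distrib[symmetric]
    by (rule sum.cong) (simp_all add: power2_eq_square algebra_simps)
  then have "\<rho> \<bullet> (L *v (\<chi> x. (u $ x)\<^sup>2)) =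
      2 * (\<Sum>x\<in>UNIV. \<rho> $ x * (u $ x * (L *v u) $ x)) + dirichlet u"
    by (simp add: inner_vec_def dirichlet_def distrib_left sum.distrib sum_distrib_left mult_ac)
  then show ?thesis
    using inner_stationary_generator[of "\<chi> x. (u $ x)\<^sup>2"] by simp
qed

lemma dirichlet_nonneg: "dirichlet u \<ge> 0"
  unfolding dirichlet_def
  by (intro sum_nonneg mult_nonneg_nonneg rate_nonneg less_imp_le[OF stationary_pos]) simp

text \<open>All summands are nonnegative and \<open>\<rho>\<close> is positive, so \<open>u\<close>
  agrees across each positive rate, hence everywhere by connectivity.\<close>

lemma dirichlet_eq_0D:
  assumes "dirichlet u = 0"
  shows "u $ x = u $ y"
proof -
  have nonneg: "(\<Sum>y\<in>UNIV. k x y * (u $ y - u $ x)\<^sup>2) \<ge> 0" for x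
    by (intro sum_nonneg mult_nonneg_nonneg rate_nonneg) simp
  have sum0: "(\<Sum>y\<in>UNIV. k x y * (u $ y - u $ x)\<^sup>2) = 0" for x
  proof -
    have "\<rho> $ x * (\<Sum>y\<in>UNIV. k x y * (u $ y - u $ x)\<^sup>2) = 0"
      using sum_nonneg_0[of UNIV "\<lambda>x. \<rho> $ x * (\<Sum>y\<in>UNIV. k x y * (u $ y - u $ x)\<^sup>2)" x] assms
      by (simp add: dirichlet_def nonneg less_imp_le[OF stationary_pos])
    then show ?thesis
      using stationary_pos[of x] by auto
  qed
  have "u $ y = u $ x" if "k x y > 0" for x y
  proof -
    have "k x y * (u $ y - u $ x)\<^sup>2 = 0"
      using sum_nonneg_0[of UNIV "\<lambda>y. k x y * (u $ y - u $ x)\<^sup>2" y] sum0[of x]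
      by (simp add: rate_nonneg)
    then show ?thesis
      using that by simp
  qed
  then show ?thesis
    using rtrancl_UNIV_invariant[OF irreducible, of "\<lambda>y. u $ x = u $ y" x y] by auto
qed

section \<open>Functions of mean zero: Poincare inequality and decay\<close>

lemma centred_eq_0:
  assumes "dirichlet u = 0" "\<rho> \<bullet> u = 0"
  shows "u = 0"
proof -
  have u: "u = (\<chi> x. u $ y)" for y
    using dirichlet_eq_0D[OF assms(1)] by (simp add: vec_eq_iff)
  then have "u $ y = 0" for y
    using assms(2) inner_stationary_one[of "u $ y"] by metis
  then show ?thesis
    by (simp add: vec_eq_iff)
qed

text \<open>By compactness the Dirichlet form attains its minimum on the centred unit sphere, and
  \<open>centred_eq_0\<close> makes it positive; homogeneity of degree two extends the
  bound.\<close>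

lemma poincare:
  obtains c where "c > 0" "\<And>u. \<rho> \<bullet> u = 0 \<Longrightarrow> c * (norm u)\<^sup>2 \<le> dirichlet u"
proof -
  define K where "K = sphere 0 1 \<inter> {u. \<rho> \<bullet> u = 0}"
  have "compact K"
    unfolding K_def by (intro compact_Int_closed compact_sphere closed_hyperplane)
  have cont: "continuous_on K dirichlet"
    unfolding dirichlet_def by (intro continuous_intros)
  obtain c where c: "c > 0" "\<And>u. u \<in> K \<Longrightarrow> c \<le> dirichlet u"
  proof (cases "K = {}")
    case True
    \<comment> \<open>With a single vertex there is no centred unit vector, and any positive
      constant works.\<close>
    then show ?thesis using that[of 1] by auto
  next
    case False
    then obtain w where w: "w \<in> K" "\<And>u. u \<in> K \<Longrightarrow> dirichlet w \<le> dirichlet u"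
      using continuous_attains_inf[OF \<open>compact K\<close> False cont] by auto
    have "dirichlet w \<noteq> 0"
      using w(1) centred_eq_0[of w] by (auto simp: K_def)
    then show ?thesis
      using that[of "dirichlet w"] w(2) dirichlet_nonneg[of w] by force
  qed
  have "c * (norm u)\<^sup>2 \<le> dirichlet u" if "\<rho> \<bullet> u = 0" for u
  proof (cases "u = 0")
    case False
    define a where "a = inverse (norm u)"
    have "a *\<^sub>R u \<in> K"
      using False that by (simp add: K_def a_def)
    then have "c \<le> dirichlet (a *\<^sub>R u)"
      by (rule c(2))
    also have "\<dots> = a\<^sup>2 * dirichlet u"
      unfolding dirichlet_def sum_distrib_left
      by (intro sum.cong) (simp_all add: power2_eq_square algebra_simps)
    finally show ?thesis
      using False by (simp add: a_def field_simps)
  qed (simp add: dirichlet_nonneg)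
  with c(1) show ?thesis by (rule that)
qed

text \<open>The mean is conserved because \<open>\<rho>\<close> annihilates the range of
  \<open>L\<close>; a centred solution thus stays where the Poincare inequality applies.\<close>

lemma inner_stationary_deriv_const:
  assumes "\<And>t. (u has_vector_derivative L *v u t) (at t)"
  shows "\<rho> \<bullet> u t = \<rho> \<bullet> u 0"
proof -
  have "((\<lambda>t. \<rho> \<bullet> u t) has_vector_derivative \<rho> \<bullet> (L *v u t)) (at t)" for t
    by (rule bounded_linear.has_vector_derivative[OF bounded_linear_inner_right assms])
  then have "((\<lambda>t. \<rho> \<bullet> u t) has_real_derivative 0) (at t)" for t
    by (simp add: inner_stationary_generator has_real_derivative_iff_has_vector_derivative)
  then show ?thesis
    by (intro DERIV_isconst_all) auto
qed

lemma backward_equation_centred_decay: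
  assumes deriv: "\<And>t. (u has_vector_derivative L *v u t) (at t)" and "\<rho> \<bullet> u 0 = 0"
  shows "(u \<longlongrightarrow> 0) at_top"
proof -
  have centred: "\<rho> \<bullet> u t = 0" for t
    using inner_stationary_deriv_const[OF deriv] assms(2) by simp
  obtain c where c: "c > 0" "\<And>u. \<rho> \<bullet> u = 0 \<Longrightarrow> c * (norm u)\<^sup>2 \<le> dirichlet u"
    using poincare by blast
  define E where "E t = (\<Sum>x\<in>UNIV. \<rho> $ x * (u t $ x)\<^sup>2)" for t
  have comp: "((\<lambda>t. u t $ x) has_real_derivative (L *v u t) $ x) (at t)" for t x
    using bounded_linear.has_vector_derivative[OF bounded_linear_vec_nth deriv]
    by (simp add: has_real_derivative_iff_has_vector_derivative)
  have E_deriv: "(E has_real_derivative (\<Sum>x\<in>UNIV. \<rho> $ x * (2 * (u t $ x * (L *v u t) $ x)))) (at t)" for t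
    unfolding E_def by (auto intro!: derivative_eq_intros comp sum.cong simp: mult_ac)
  have E': "(E has_real_derivative - dirichlet (u t)) (at t)" for t
    using E_deriv[of t] dirichlet_eq[of "u t"] by (simp add: sum_distrib_left mult_ac)
  \<comment> \<open>Weights at most 1 bound the energy by the squared Euclidean norm, in which the
    Poincare inequality is stated.\<close>
  have rho_le: "\<rho> $ x \<le> 1" for x
    using stationary member_le_sum[of x UNIV "\<lambda>x. \<rho> $ x"]
    by (simp add: stationary_distribution_def)
  have "E t \<le> (norm (u t))\<^sup>2" for t
    unfolding E_def power2_norm_eq_inner inner_vec_def
    using mult_right_mono[OF rho_le zero_le_power2]
    by (intro sum_mono) (simp add: power2_eq_square)
  then have decr: "c * E t \<le> dirichlet (u t)" for t
    using c(1) c(2)[OF centred[of t]] by (meson less_imp_le mult_left_mono order_trans)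
  have E_decay: "E t \<le> E 0 * exp (- c * t)" if "0 \<le> t" for t
  proof -
    \<comment> \<open>Gronwall's argument with the integrating factor
      \<open>exp (c * t)\<close>.\<close>
    have "exp (c * t) * E t \<le> exp (c * 0) * E 0"
    proof (rule DERIV_nonpos_imp_nonincreasing[OF that])
      fix s
      have "((\<lambda>t. exp (c * t) * E t) has_real_derivative
          exp (c * s) * (c * E s - dirichlet (u s))) (at s)"
        by (rule derivative_eq_intros E' refl)+ (simp add: algebra_simps)
      moreover have "exp (c * s) * (c * E s - dirichlet (u s)) \<le> 0"
        using decr[of s] by (simp add: mult_nonneg_nonpos)
      ultimately show "\<exists>y. ((\<lambda>t. exp (c * t) * E t) has_real_derivative y) (at s) \<and> y \<le> 0"
        by blast
    qed
    then show ?thesis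
      by (simp add: exp_minus field_simps)
  qed
  have "((\<lambda>t. E 0 * exp (- c * t)) \<longlongrightarrow> 0) at_top"
    using c(1) by real_asymp
  then have E_lim: "(E \<longlongrightarrow> 0) at_top"
  proof (rule tendsto_sandwich[rotated -1])
    show "\<forall>\<^sub>F t in at_top. E t \<le> E 0 * exp (- c * t)"
      using E_decay by (auto intro: eventually_at_top_linorderI[of 0])
    show "\<forall>\<^sub>F t in at_top. 0 \<le> E t"
      unfolding E_def by (simp add: sum_nonneg less_imp_le[OF stationary_pos])
  qed simp
  show ?thesis
  proof (rule vec_tendstoI)
    fix x
    have lim: "((\<lambda>t. E t / \<rho> $ x) \<longlongrightarrow> 0) at_top"
      using tendsto_divide[OF E_lim tendsto_const[of "\<rho> $ x"]] stationary_pos[of x] by simp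
    \<comment> \<open>Positivity of \<open>\<rho>\<close> at \<open>x\<close> recovers the component
      from the energy.\<close>
    have bound: "(u t $ x)\<^sup>2 \<le> E t / \<rho> $ x" for t
    proof -
      have "\<rho> $ x * (u t $ x)\<^sup>2 \<le> E t"
        unfolding E_def by (rule member_le_sum) (simp_all add: less_imp_le[OF stationary_pos])
      then show ?thesis
        using stationary_pos[of x] by (simp add: field_simps)
    qed
    have "((\<lambda>t. (u t $ x)\<^sup>2) \<longlongrightarrow> 0) at_top"
      by (rule tendsto_sandwich[OF _ _ tendsto_const lim]) (simp_all only: bound zero_le_power2 eventually_True)
    then show "((\<lambda>t. u t $ x) \<longlongrightarrow> 0 $ x) at_top"
      by simp
  qed
qed

section \<open>The group inverse of the generator and the quasipotential\<close>

definition P :: "real^'v^'v" where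
  "P = (\<chi> x y. \<rho> $ y)"

text \<open>Hence \<open>P\<close> projects onto the constants along the functions of mean
  zero.\<close>

lemma P_mult_vec: "P *v u = (\<chi> x. \<rho> \<bullet> u)"
  by (simp add: P_def matrix_vector_mult_def inner_vec_def)

lemma generator_const: "L *v (\<chi> x. c) = 0"
  by (simp add: vec_eq_iff generator_mult_vec)

text \<open>The first three equations identify the Drazin inverse; the last two serve the
  integral.\<close>

lemma group_inverse_exists:
  obtains D where "L ** D ** L = L" "D ** L ** D = D" "L ** D = D ** L"
    "L ** D = mat 1 - P" "P ** D = 0"
proof -
  have LP: "L ** P = 0" and PL: "P ** L = 0" and PP: "P ** P = P"
    by (simp_all add: matrix_eq matrix_vector_mul_assoc[symmetric] P_mult_vec generator_const
        inner_stationary_generator inner_stationary_one flip: zero_vec_def)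
  \<comment> \<open>Pairing L u = P u with \<open>\<rho>\<close> shows that the mean is zero; then L
    u = 0, so the Dirichlet form vanishes.\<close>
  have "u = 0" if "(L - P) *v u = 0" for u
  proof -
    have Lu: "L *v u = (\<chi> x. \<rho> \<bullet> u)"
      using that by (simp add: matrix_vector_mult_diff_rdistrib P_mult_vec)
    have centred: "\<rho> \<bullet> u = 0"
      using arg_cong[OF Lu, of "(\<bullet>) \<rho>"]
      by (simp add: inner_stationary_generator inner_stationary_one)
    then have "dirichlet u = 0"
      using dirichlet_eq[of u] by (simp add: Lu)
    then show ?thesis
      using centred by (rule centred_eq_0)
  qed
  then obtain M where M: "M ** (L - P) = mat 1"
    using matrix_left_invertible_ker[of "L - P"] by auto
  then have M': "(L - P) ** M = mat 1"
    by (simp add: matrix_left_right_inverse)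
  have MP: "M ** P = - P"
  proof -
    have "P = M ** ((L - P) ** P)"
      by (simp add: matrix_mul_assoc M)
    also have "\<dots> = - (M ** P)"
      using matrix_diff_ldistrib[of M 0 P] by (simp add: matrix_diff_rdistrib LP PP)
    finally show ?thesis by (metis minus_minus)
  qed
  have PM: "P ** M = - P"
  proof -
    have "P = (P ** (L - P)) ** M"
      by (simp add: M' flip: matrix_mul_assoc)
    also have "\<dots> = - (P ** M)"
      using matrix_diff_rdistrib[of 0 P M] by (simp add: matrix_diff_ldistrib PL PP)
    finally show ?thesis by (metis minus_minus)
  qed
  \<comment> \<open>\<open>M\<close> acts on constants as -1; adding \<open>P\<close> cancels this,
    so \<open>D\<close> annihilates them.\<close>
  define D where "D = M + P"
  have LD: "L ** D = mat 1 - P"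
    using M' PM by (simp add: D_def matrix_add_ldistrib LP matrix_diff_rdistrib algebra_simps)
  have DL: "D ** L = mat 1 - P"
    using M MP by (simp add: D_def matrix_add_rdistrib PL matrix_diff_ldistrib algebra_simps)
  have PD: "P ** D = 0"
    by (simp add: D_def matrix_add_ldistrib PM PP)
  show ?thesis
    by (rule that[of D]) (simp_all add: LD DL PD matrix_diff_rdistrib PL)
qed

lemma quasipotential_has_integral:
  assumes "P ** D = 0" "L ** D = mat 1 - P" "\<rho> \<bullet> f = 0"
  shows "((\<lambda>t. backward_semigroup L t *v f) has_integral - (D *v f)) {0..}"
proof -
  let ?u = "\<lambda>t. backward_semigroup L t *v (D *v f)"
  have "L *v (D *v f) = f"
    using assms
    by (simp add: matrix_vector_mul_assoc matrix_vector_mult_diff_rdistrib P_mult_vec zero_vec_def[symmetric])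
  then have Lu: "L *v ?u t = backward_semigroup L t *v f" for t
    by (metis backward_semigroup_commute matrix_vector_mul_assoc)
  have deriv: "(?u has_vector_derivative L *v ?u t) (at t)" for t
    by (rule backward_semigroup_mult_vec_deriv)
  \<comment> \<open>This makes the initial value \<open>D *v f\<close> centred, so that the orbit
    decays.\<close>
  have "P *v (D *v f) = 0"
    by (simp add: matrix_vector_mul_assoc assms(1))
  then have "\<rho> \<bullet> ?u 0 = 0"
    by (simp add: P_mult_vec backward_semigroup_0 vec_eq_iff)
  then have "(?u \<longlongrightarrow> 0) at_top"
    by (rule backward_equation_centred_decay[OF deriv])
  then have "((\<lambda>t. L *v ?u t) has_integral - ?u 0) {0..}"
    using deriv by (intro has_integral_derivative_vanishing_at_top)
  then show ?thesis
    by (simp add: Lu backward_semigroup_0)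
qed

end

text \<open>A \<open>pair_graph\<close> contains the reverse of every arc, so connectedness is
  strong connectedness, and arcs carry positive rates.\<close>

lemma pair_graph_rates_irreducible:
  assumes "pair_graph G" "pverts G = UNIV" "Digraph_Component.connected (with_proj G)"
    and "\<And>x y. (x, y) \<in> parcs G \<Longrightarrow> (k x y :: real) > 0"
  shows "{(x, y). k x y > 0}\<^sup>* = UNIV"
proof -
  interpret pair_graph G by fact
  have "strongly_connected (with_proj G)"
    using symmetric_connected_imp_strongly_connected[OF pair_sym_arcs assms(3)] .
  then have "(x, y) \<in> (parcs G)\<^sup>*" for x y
    using assms(2) reachable_rtranclI[of "with_proj G" x y]
    by (simp add: strongly_connected_def)
  moreover have "(parcs G)\<^sup>* \<subseteq> {(x, y). k x y > 0}\<^sup>*"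
    using assms(4) by (intro rtrancl_mono) auto
  ultimately show ?thesis by auto
qed

theorem mainTheorem1:
  fixes G :: "'v::finite pair_pre_digraph"
    and k :: "'v \<Rightarrow> 'v \<Rightarrow> real"
    and L :: "real^'v^'v"
    and \<rho> f :: "real^'v"
  assumes "pair_graph G"
    and "pverts G = UNIV"
    and "Digraph_Component.connected (with_proj G)"
    and "\<And>x y. (x, y) \<in> parcs G \<Longrightarrow> k x y > 0"
    and "\<And>x y. (x, y) \<notin> parcs G \<Longrightarrow> k x y = 0"
    and "L = generator k"
    and "stationary_distribution L \<rho>"
    and "(\<Sum>x\<in>UNIV. \<rho> $ x * f $ x) = 0"
  shows "(\<lambda>t. backward_semigroup L t *v f) integrable_on {0..} \<and>
    complex_vector (quasipotential L f) =
      - (drazin_inverse (map_matrix complex_of_real L) *v complex_vector f)"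
proof -
  interpret irreducible_markov k \<rho>
  proof
    show "k x y \<ge> 0" for x y
      using assms(4)[of x y] assms(5)[of x y] by (cases "(x, y) \<in> parcs G") auto
    show "{(x, y). k x y > 0}\<^sup>* = UNIV"
      using assms(1-4) by (rule pair_graph_rates_irreducible)
    show "stationary_distribution (generator k) \<rho>"
      using assms(6,7) by simp
  qed
  obtain D where D: "generator k ** D ** generator k = generator k"
      "D ** generator k ** D = D" "generator k ** D = D ** generator k"
      "generator k ** D = mat 1 - P" "P ** D = 0"
    by (rule group_inverse_exists)
  \<comment> \<open>\<open>has_integral\<close> yields the value together with integrability,
    without which \<open>integral\<close> would be a mere default.\<close>
  have "((\<lambda>t. backward_semigroup L t *v f) has_integral - (D *v f)) {0..}"
    using quasipotential_has_integral[OF D(5,4)] assms(6,8) by (simp add: inner_vec_def)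
  \<comment> \<open>The embedding of the reals respects matrix products, so the three equations
    carry over and uniqueness among complex matrices applies.\<close>
  moreover have "drazin_inverse (map_matrix complex_of_real L) = map_matrix complex_of_real D"
    using D(1-3) assms(6) by (intro drazin_inverse_eqI) (simp_all flip: map_matrix_of_real_mult)
  moreover have "complex_vector (- (D *v f)) = - (map_matrix complex_of_real D *v complex_vector f)"
    by (simp add: complex_vector_def matrix_vector_mult_def vec_eq_iff)
  ultimately show ?thesis
    by (auto simp: quasipotential_def dest: integral_unique)
qed

end
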